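(* Let $v,d\ge0$. A DCF formula of $\mathcal{F}(v,d)$ is a theorem of $\mathbf{E}$ if and only if it is the disjunction of all the DCF minterms of $\mathcal{F}(v,d)$.
   Context: Language: propositional variables $p_1,p_2,\dots$, constants $0,1$, connectives $\neg,\vee,\wedge$, modal operator $\lozenge$. $\mathbf{E}$ is the smallest set of formulas containing all propositional tautologies and closed under modus ponens, uniform substitution and the rule RE: from $\varphi\leftrightarrow\psi$ infer $\lozenge\varphi\leftrightarrow\lozenge\psi$. $\mathcal{F}(v,d)$ is the set of formulas in variables among $p_1,\dots,p_v$ with $\lozenge$-nesting depth $\le d$. Disjunctive canonical forms (DCF), for fixed $v$, defined by recursion on $d$: a level-0 minterm is a conjunction $\pm p_1\wedge\dots\wedge\pm p_v$ (each variable plain or negated; for $v=0$ the single minterm is $1$); a DCF formula of $\mathcal{F}(v,0)$ is a disjunction of a set of distinct level-0 minterms (the empty disjunction being $0$). For $d\ge1$, the level-$d$ modal factors are the formulas $\lozenge\phi$ with $\phi$ ranging over all DCF formulas of $\mathcal{F}(v,d-1)$; a level-$d$ minterm (DCF minterm of $\mathcal{F}(v,d)$) is the conjunction of a level-0 minterm with all the level-$d$ modal factors, each occurring either plain or negated; a DCF formula of $\mathcal{F}(v,d)$ is a disjunction of a set of distinct level-$d$ minterms ($0$ if the set is empty). *)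

theory Defs imports Main begin

(* Var i stands for p_(i+1), so the variables p_1, ..., p_v are Var 0, ..., Var (v - 1). *)
datatype fm =
    Var nat
  | Bot
  | Top
  | Neg fm
  | Or fm fm
  | And fm fm
  | Dia fm

abbreviation Imp :: "fm \<Rightarrow> fm \<Rightarrow> fm" where
  "Imp a b \<equiv> Or (Neg a) b"

abbreviation Iff :: "fm \<Rightarrow> fm \<Rightarrow> fm" where
  "Iff a b \<equiv> And (Imp a b) (Imp b a)"

primrec subst :: "(nat \<Rightarrow> fm) \<Rightarrow> fm \<Rightarrow> fm" where
  "subst s (Var i) = s i"
| "subst s Bot = Bot"
| "subst s Top = Top"
| "subst s (Neg a) = Neg (subst s a)"
| "subst s (Or a b) = Or (subst s a) (subst s b)"
| "subst s (And a b) = And (subst s a) (subst s b)"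
| "subst s (Dia a) = Dia (subst s a)"

(* Formulas Dia a are treated as further propositional atoms, with truth value g a. *)
primrec eval :: "(nat \<Rightarrow> bool) \<Rightarrow> (fm \<Rightarrow> bool) \<Rightarrow> fm \<Rightarrow> bool" where
  "eval f g (Var i) = f i"
| "eval f g Bot = False"
| "eval f g Top = True"
| "eval f g (Neg a) = (\<not> eval f g a)"
| "eval f g (Or a b) = (eval f g a \<or> eval f g b)"
| "eval f g (And a b) = (eval f g a \<and> eval f g b)"
| "eval f g (Dia a) = g a"

definition tautology :: "fm \<Rightarrow> bool" where
  "tautology a \<longleftrightarrow> (\<forall>f g. eval f g a)"

inductive_set logic_E :: "fm set" where
  Taut: "tautology a \<Longrightarrow> a \<in> logic_E"
| MP: "Imp a b \<in> logic_E \<Longrightarrow> a \<in> logic_E \<Longrightarrow> b \<in> logic_E"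
| US: "a \<in> logic_E \<Longrightarrow> subst s a \<in> logic_E"
| RE: "Iff a b \<in> logic_E \<Longrightarrow> Iff (Dia a) (Dia b) \<in> logic_E"

fun conj_list :: "fm list \<Rightarrow> fm" where
  "conj_list [] = Top"
| "conj_list [a] = a"
| "conj_list (a # b # as) = And a (conj_list (b # as))"

fun disj_list :: "fm list \<Rightarrow> fm" where
  "disj_list [] = Bot"
| "disj_list [a] = a"
| "disj_list (a # b # as) = Or a (disj_list (b # as))"

primrec vars :: "fm \<Rightarrow> nat set" where
  "vars (Var i) = {i}"
| "vars Bot = {}"
| "vars Top = {}"
| "vars (Neg a) = vars a"
| "vars (Or a b) = vars a \<union> vars b"
| "vars (And a b) = vars a \<union> vars b"
| "vars (Dia a) = vars a"

primrec depth :: "fm \<Rightarrow> nat" where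
  "depth (Var i) = 0"
| "depth Bot = 0"
| "depth Top = 0"
| "depth (Neg a) = depth a"
| "depth (Or a b) = max (depth a) (depth b)"
| "depth (And a b) = max (depth a) (depth b)"
| "depth (Dia a) = Suc (depth a)"

definition formulas :: "nat \<Rightarrow> nat \<Rightarrow> fm set" where
  "formulas v d = {a. vars a \<subseteq> {..<v} \<and> depth a \<le> d}"

definition signings :: "fm list \<Rightarrow> fm list list" where
  "signings as = product_lists (map (\<lambda>a. [a, Neg a]) as)"

definition minterms0 :: "nat \<Rightarrow> fm list" where
  "minterms0 v = map conj_list (signings (map Var [0..<v]))"

(* The minterms are enumerated without repetition in a fixed order, and a set of minterms is
   represented by the subsequence of this enumeration that lists it. Hence every set of minterms
   has exactly one disjunction, and there is exactly one modal factor per set. *)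
primrec minterms :: "nat \<Rightarrow> nat \<Rightarrow> fm list" where
  "minterms v 0 = minterms0 v"
| "minterms v (Suc d) =
     [And m (conj_list fs).
        m \<leftarrow> minterms0 v,
        fs \<leftarrow> signings (map (\<lambda>ms. Dia (disj_list ms)) (subseqs (minterms v d)))]"

definition dcf_formulas :: "nat \<Rightarrow> nat \<Rightarrow> fm set" where
  "dcf_formulas v d = disj_list ` set (subseqs (minterms v d))"

lemma conj_list_inj:
  "length as = length bs \<Longrightarrow> conj_list as = conj_list bs \<Longrightarrow> as = bs"
proof (induction as arbitrary: bs rule: conj_list.induct)
  case (2 a)
  then show ?case by (cases bs) auto
next
  case (3 a b as)
  then obtain a' b' as' where "bs = a' # b' # as'"
    by (metis Suc_length_conv)
  with 3 show ?case
    using "3.IH"[of "b' # as'"] by simp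
qed simp

lemma length_signings: "as \<in> set (signings bs) \<Longrightarrow> length as = length bs"
  unfolding signings_def by (metis in_set_product_lists_length length_map)

lemma distinct_signings: "distinct (signings as)"
  unfolding signings_def
proof (induction as)
  case (Cons a as)
  have "a \<noteq> Neg a"
    by (metis add.right_neutral add_Suc_right fm.size(11) n_not_Suc_n)
  with Cons show ?case
    by (auto simp: distinct_map inj_on_def)
qed simp

lemma inj_on_conj_signings: "inj_on conj_list (set (signings as))"
  by (rule inj_onI) (metis conj_list_inj length_signings)

lemma distinct_minterms0: "distinct (minterms0 v)"
  unfolding minterms0_def by (simp add: distinct_map distinct_signings inj_on_conj_signings)

lemma distinct_concat_pairs:
  assumes "distinct xs" "distinct ys" "inj_on h (set ys)"
  shows "distinct (concat (map (\<lambda>x. map (\<lambda>y. And x (h y)) ys) xs))"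
  using assms by (induction xs) (auto simp: distinct_map inj_on_def)

lemma distinct_minterms: "distinct (minterms v d)"
  by (cases d)
    (auto intro!: distinct_minterms0 distinct_concat_pairs distinct_signings inj_on_conj_signings)

lemma minterm_shape:
  assumes "m \<in> set (minterms v d)"
  shows "m \<noteq> Bot \<and> m \<noteq> Or a b"
proof (cases d)
  case 0
  have *: "conj_list as \<noteq> Bot \<and> conj_list as \<noteq> Or a b"
    if "\<forall>x\<in>set as. x \<noteq> Bot \<and> x \<noteq> Or a b" for as
    using that by (induction as rule: conj_list.induct) auto
  have "x \<noteq> Bot \<and> x \<noteq> Or a b"
    if "as \<in> set (signings (map Var [0..<v]))" "x \<in> set as" for as x
  proof -
    have "list_all2 (\<lambda>x b. x = b \<or> x = Neg b) as (map Var [0..<v])"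
      using that(1) by (simp add: signings_def product_lists_set list_all2_map2)
    then obtain i where "x = Var i \<or> x = Neg (Var i)"
      using \<open>x \<in> set as\<close> by (auto simp: in_set_conv_nth list_all2_conv_all_nth)
    then show ?thesis by auto
  qed
  moreover obtain as where "as \<in> set (signings (map Var [0..<v]))" "m = conj_list as"
    using 0 assms by (auto simp: minterms0_def)
  ultimately show ?thesis
    using *[of as] by simp
qed (use assms in auto)

lemma disj_list_inj:
  assumes "\<forall>x\<in>set as \<union> set bs. x \<noteq> Bot \<and> (\<forall>a b. x \<noteq> Or a b)"
    and "disj_list as = disj_list bs"
  shows "as = bs"
  using assms
proof (induction as arbitrary: bs rule: disj_list.induct)
  case 1
  then show ?case by (cases bs rule: disj_list.cases) auto
next
  case (2 a)
  then show ?case by (cases bs rule: disj_list.cases) auto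
next
  case (3 a b as)
  then show ?case
  proof (cases bs rule: disj_list.cases)
    case (3 a' b' as')
    then show ?thesis
      using "3.IH"[of "b' # as'"] "3.prems" by simp
  qed auto
qed

lemma inj_on_disj_subseqs: "inj_on disj_list (set (subseqs (minterms v d)))"
proof (rule inj_onI, rule disj_list_inj)
  fix as bs
  assume "as \<in> set (subseqs (minterms v d))" "bs \<in> set (subseqs (minterms v d))"
  then have "set as \<subseteq> set (minterms v d)" "set bs \<subseteq> set (minterms v d)"
    using subseqs_powset[of "minterms v d"] by blast+
  then show "\<forall>x\<in>set as \<union> set bs. x \<noteq> Bot \<and> (\<forall>a b. x \<noteq> Or a b)"
    using minterm_shape by blast
qed

lemma conj_list_formulas: "set as \<subseteq> formulas v d \<Longrightarrow> conj_list as \<in> formulas v d"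
  by (induction as rule: conj_list.induct) (auto simp: formulas_def)

lemma disj_list_formulas: "set as \<subseteq> formulas v d \<Longrightarrow> disj_list as \<in> formulas v d"
  by (induction as rule: disj_list.induct) (auto simp: formulas_def)

lemma signings_formulas:
  assumes "as \<in> set (signings bs)" "set bs \<subseteq> formulas v d"
  shows "set as \<subseteq> formulas v d"
proof -
  have "list_all2 (\<lambda>x b. x = b \<or> x = Neg b) as bs"
    using assms(1) by (simp add: signings_def product_lists_set list_all2_map2)
  then show ?thesis
    using assms(2) by (induction rule: list_all2_induct) (auto simp: formulas_def)
qed

lemma minterms0_formulas: "set (minterms0 v) \<subseteq> formulas v d"
proof
  fix m assume "m \<in> set (minterms0 v)"
  then obtain as where "as \<in> set (signings (map Var [0..<v]))" "m = conj_list as"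
    by (auto simp: minterms0_def)
  moreover have "set (map Var [0..<v]) \<subseteq> formulas v d"
    by (auto simp: formulas_def)
  ultimately show "m \<in> formulas v d"
    using conj_list_formulas signings_formulas by blast
qed

lemma minterms_formulas: "set (minterms v d) \<subseteq> formulas v d"
proof (induction d)
  case (Suc d)
  have *: "set (map (\<lambda>ms. Dia (disj_list ms)) (subseqs (minterms v d))) \<subseteq> formulas v (Suc d)"
  proof -
    have "disj_list ms \<in> formulas v d" if "ms \<in> set (subseqs (minterms v d))" for ms
      using that Suc subseqs_powset[of "minterms v d"] by (intro disj_list_formulas) blast
    then show ?thesis by (fastforce simp: formulas_def)
  qed
  have "And m (conj_list fs) \<in> formulas v (Suc d)"
    if "m \<in> set (minterms0 v)"
      "fs \<in> set (signings (map (\<lambda>ms. Dia (disj_list ms)) (subseqs (minterms v d))))" for m fs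
    using conj_list_formulas[OF signings_formulas[OF that(2) *]] minterms0_formulas that(1)
    by (fastforce simp: formulas_def)
  then show ?case by auto
qed (simp add: minterms0_formulas)

lemma dcf_formulas_subset: "dcf_formulas v d \<subseteq> formulas v d"
proof -
  have "disj_list ms \<in> formulas v d" if "ms \<in> set (subseqs (minterms v d))" for ms
    using that minterms_formulas[of v d] subseqs_powset[of "minterms v d"]
    by (intro disj_list_formulas) blast
  then show ?thesis by (auto simp: dcf_formulas_def)
qed

end

theory Submission imports Defs begin

text \<open>A truth assignment \<open>g\<close> to the formulas \<open>Dia a\<close> that respects provable equivalence makes all
  theorems of \<^const>\<open>logic_E\<close> true, so it suffices to satisfy every minterm by such an assignment.
  This goes by induction on the level. If all level-\<open>d\<close> minterms are satisfiable, then, being mutually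
  exclusive, distinct DCF formulas of level \<open>d\<close> are not provably equivalent. Hence the
  signs of the modal factors in a level-\<open>Suc d\<close> minterm can be extended to all formulas along
  provable equivalence without conflict. Conversely, every assignment satisfies some minterm, so
  the full disjunction is a tautology.\<close>

text \<open>Such a \<open>g\<close> is a predicate on the Lindenbaum algebra of E; it stands in for
  the neighbourhood family of a single world.\<close>

definition congruential :: "(fm \<Rightarrow> bool) \<Rightarrow> bool" where
  "congruential g \<longleftrightarrow> (\<forall>a b. Iff a b \<in> logic_E \<longrightarrow> g a = g b)"

lemma subst_subst: "subst s (subst t a) = subst (\<lambda>i. subst s (t i)) a"
  by (induction a) auto

lemma subst_Var: "subst Var a = a"
  by (induction a) auto

text \<open>\<open>Dia b\<close> is an atom for \<open>eval\<close>, but substitution acts inside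
  it, so \<open>g\<close> has to be reindexed along with \<open>f\<close>.\<close>

lemma eval_subst: "eval f g (subst s a) = eval (\<lambda>i. eval f g (s i)) (\<lambda>b. g (subst s b)) a"
  by (induction a) auto

lemma logic_E_sound:
  assumes "a \<in> logic_E" "congruential g"
  shows "eval f g a"
proof -
  \<comment> \<open>Quantifying over all substitutions makes the induction pass through the rule \<open>US\<close>.\<close>
  have "eval f g (subst s a)" for s
    using assms(1)
  proof (induction arbitrary: s)
    case (Taut a)
    then show ?case by (simp add: tautology_def eval_subst)
  next
    case (MP a b)
    from MP.IH(1)[of s] MP.IH(2)[of s] show ?case by simp
  next
    case (US a t)
    then show ?case by (simp add: subst_subst)
  next
    case (RE a b)
    \<comment> \<open>Congruentiality asks for provability of the equivalence, not its truth under
      \<open>g\<close>; hence the premise of the rule is itself substituted.\<close>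
    have "Iff (subst s a) (subst s b) \<in> logic_E"
      using logic_E.US[OF RE.hyps, of s] by simp
    with assms(2) show ?case by (simp add: congruential_def)
  qed
  from this[of Var] show ?thesis by (simp add: subst_Var)
qed

lemma logic_E_Iff_trans:
  assumes "Iff a b \<in> logic_E" "Iff b c \<in> logic_E"
  shows "Iff a c \<in> logic_E"
proof -
  have "tautology (Imp (Iff a b) (Imp (Iff b c) (Iff a c)))"
    by (auto simp: tautology_def)
  then show ?thesis using assms by (meson logic_E.Taut logic_E.MP)
qed

lemma logic_E_Iff_sym:
  assumes "Iff a b \<in> logic_E"
  shows "Iff b a \<in> logic_E"
proof -
  have "tautology (Imp (Iff a b) (Iff b a))"
    by (auto simp: tautology_def)
  then show ?thesis using assms by (meson logic_E.Taut logic_E.MP)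
qed

lemma logic_E_Iff_refl: "Iff a a \<in> logic_E"
  by (rule logic_E.Taut) (simp add: tautology_def)

lemma eval_conj_list: "eval f g (conj_list as) \<longleftrightarrow> (\<forall>a\<in>set as. eval f g a)"
  by (induction as rule: conj_list.induct) auto

lemma eval_disj_list: "eval f g (disj_list as) \<longleftrightarrow> (\<exists>a\<in>set as. eval f g a)"
  by (induction as rule: disj_list.induct) auto

lemma signings_iff: "as \<in> set (signings cs) \<longleftrightarrow> list_all2 (\<lambda>x c. x = c \<or> x = Neg c) as cs"
  by (simp add: signings_def product_lists_set list_all2_map2)

lemma signing_true_exists: "\<exists>as\<in>set (signings cs). eval f g (conj_list as)"
proof
  let ?as = "map (\<lambda>c. if eval f g c then c else Neg c) cs"
  show "?as \<in> set (signings cs)"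
    by (auto simp: signings_iff list_all2_conv_all_nth)
  show "eval f g (conj_list ?as)"
    by (auto simp: eval_conj_list)
qed

lemma signing_true_unique:
  assumes "as \<in> set (signings cs)" "bs \<in> set (signings cs)"
    and "eval f g (conj_list as)" "eval f g (conj_list bs)"
  shows "as = bs"
proof (rule nth_equalityI)
  show "length as = length bs"
    using assms(1,2) by (simp add: length_signings)
  fix i assume i: "i < length as"
  then have "eval f g (as ! i)" "eval f g (bs ! i)"
    using assms(3,4) \<open>length as = length bs\<close> by (auto simp: eval_conj_list)
  moreover have "as ! i = cs ! i \<or> as ! i = Neg (cs ! i)" "bs ! i = cs ! i \<or> bs ! i = Neg (cs ! i)"
    using assms(1,2) i \<open>length as = length bs\<close> by (auto simp: signings_iff list_all2_conv_all_nth)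
  ultimately show "as ! i = bs ! i" by auto
qed

text \<open>As \<open>cs\<close> is distinct and contains no negations, membership of
  \<open>c\<close> in \<open>as\<close> records exactly the sign that \<open>c\<close> carries at
  its own position.\<close>

lemma signing_true:
  assumes as: "as \<in> set (signings cs)" and "distinct cs" and "\<And>a. Neg a \<notin> set cs"
    and eval: "\<And>c. c \<in> set cs \<Longrightarrow> eval f g c \<longleftrightarrow> c \<in> set as"
  shows "eval f g (conj_list as)"
  unfolding eval_conj_list
proof
  fix x assume "x \<in> set as"
  have len: "length as = length cs"
    using as by (rule length_signings)
  have nth: "as ! i = cs ! i \<or> as ! i = Neg (cs ! i)" if "i < length cs" for i
    using as that by (auto simp: signings_iff list_all2_conv_all_nth)
  obtain i where i: "i < length cs" "x = as ! i"
    using \<open>x \<in> set as\<close> len by (metis in_set_conv_nth)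
  show "eval f g x"
  proof (cases "x = cs ! i")
    case True
    then show ?thesis using eval i \<open>x \<in> set as\<close> by simp
  next
    case False
    then have x: "x = Neg (cs ! i)" using nth i by auto
    \<comment> \<open>An occurrence at position \<open>j\<close> would be plain, since
      \<open>cs ! i\<close> is no negation; distinctness then gives \<open>j = i\<close>, where the
      sign is negative.\<close>
    have "cs ! i \<notin> set as"
    proof
      assume "cs ! i \<in> set as"
      then obtain j where j: "j < length cs" "cs ! i = as ! j"
        using len by (metis in_set_conv_nth)
      then have "cs ! i = cs ! j"
        using nth[of j] assms(3) i by (metis nth_mem)
      then have "i = j"
        using \<open>distinct cs\<close> i j by (simp add: nth_eq_iff_index_eq)
      then show False using False i j by simp
    qed
    then show ?thesis using x eval i by simp
  qed
qed

abbreviation modal_factors :: "nat \<Rightarrow> nat \<Rightarrow> fm list" where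
  "modal_factors v d \<equiv> map (\<lambda>ms. Dia (disj_list ms)) (subseqs (minterms v d))"

lemma minterm_true_exists: "\<exists>m\<in>set (minterms v d). eval f g m"
proof (cases d)
  case 0
  then show ?thesis
    using signing_true_exists[of "map Var [0..<v]" f g] by (auto simp: minterms0_def)
next
  case (Suc e)
  then show ?thesis
    using signing_true_exists[of "map Var [0..<v]" f g] signing_true_exists[of "modal_factors v e" f g]
    by (auto simp: minterms0_def)
qed

lemma minterm0_true_unique:
  assumes "m \<in> set (minterms0 v)" "m' \<in> set (minterms0 v)" "eval f g m" "eval f g m'"
  shows "m = m'"
  using assms signing_true_unique unfolding minterms0_def by fastforce

text \<open>Exclusivity is purely propositional: two different signings disagree on some atom,
  whatever \<open>g\<close> is.\<close>

lemma minterm_true_unique: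
  assumes "m \<in> set (minterms v d)" "m' \<in> set (minterms v d)" "eval f g m" "eval f g m'"
  shows "m = m'"
proof (cases d)
  case 0
  then show ?thesis using assms minterm0_true_unique by simp
next
  case (Suc e)
  obtain n fs where m: "m = And n (conj_list fs)" "n \<in> set (minterms0 v)"
      "fs \<in> set (signings (modal_factors v e))"
    using assms(1) Suc by auto
  obtain n' fs' where m': "m' = And n' (conj_list fs')" "n' \<in> set (minterms0 v)"
      "fs' \<in> set (signings (modal_factors v e))"
    using assms(2) Suc by auto
  have "n = n'"
    using m m' assms(3,4) minterm0_true_unique by auto
  moreover have "fs = fs'"
    using m m' assms(3,4) signing_true_unique by auto
  ultimately show ?thesis using m m' by simp
qed

lemma subseqs_eqI_set_eq:
  assumes "distinct xs" "as \<in> set (subseqs xs)" "bs \<in> set (subseqs xs)" "set as = set bs"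
  shows "as = bs"
  using distinct_set_subseqs[OF assms(1)] assms(2-) by (auto simp: distinct_map dest: inj_onD)

lemma distinct_modal_factors: "distinct (modal_factors v d)"
proof -
  have "distinct (subseqs (minterms v d))"
    using distinct_set_subseqs[OF distinct_minterms[of v d]] by (simp add: distinct_map)
  moreover have "inj_on (\<lambda>ms. Dia (disj_list ms)) (set (subseqs (minterms v d)))"
    using inj_on_disj_subseqs by (auto simp: inj_on_def)
  ultimately show ?thesis by (simp add: distinct_map)
qed

text \<open>Level-0 minterms contain no \<open>Dia\<close>, so one \<open>f\<close> works for all
  \<open>g\<close> and can later be combined with a \<open>g\<close> chosen separately.\<close>

lemma minterm0_satisfiable:
  assumes "m \<in> set (minterms0 v)"
  obtains f where "\<And>g. eval f g m"
proof -
  obtain as where as: "as \<in> set (signings (map Var [0..<v]))" "m = conj_list as"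
    using assms by (auto simp: minterms0_def)
  have "eval (\<lambda>i. Var i \<in> set as) g m" for g
    unfolding as(2) using as(1) by (rule signing_true) (auto simp: distinct_map inj_on_def)
  then show thesis by (rule that)
qed

lemma minterm_satisfiable:
  assumes "m \<in> set (minterms v d)"
  shows "\<exists>f g. congruential g \<and> eval f g m"
  using assms
proof (induction d arbitrary: m)
  case 0
  then obtain f where "\<And>g. eval f g m"
    using minterm0_satisfiable by auto
  moreover have "congruential (\<lambda>_. False)"
    by (simp add: congruential_def)
  ultimately show ?case by blast
next
  case (Suc d)
  obtain n fs where m: "m = And n (conj_list fs)" "n \<in> set (minterms0 v)"
      "fs \<in> set (signings (modal_factors v d))"
    using Suc.prems by auto
  obtain f where f: "\<And>g. eval f g n"
    using m(2) minterm0_satisfiable by blast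
  \<comment> \<open>A congruential model of \<open>k\<close> makes \<open>disj_list ms\<close> true,
    hence by soundness also \<open>disj_list ms'\<close>; the disjunct true there can only be
    \<open>k\<close>.\<close>
  have equivalent_subset: "set ms \<subseteq> set ms'"
    if "ms \<in> set (subseqs (minterms v d))" "ms' \<in> set (subseqs (minterms v d))"
      "Iff (disj_list ms) (disj_list ms') \<in> logic_E" for ms ms'
  proof
    fix k assume "k \<in> set ms"
    have sub: "set ms \<subseteq> set (minterms v d)" "set ms' \<subseteq> set (minterms v d)"
      using that subseqs_powset[of "minterms v d"] by blast+
    with \<open>k \<in> set ms\<close> obtain f' g' where fg: "congruential g'" "eval f' g' k"
      using Suc.IH by blast
    then have "eval f' g' (disj_list ms')"
      using logic_E_sound[OF that(3) fg(1), of f'] \<open>k \<in> set ms\<close> by (auto simp: eval_disj_list)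
    then obtain k' where "k' \<in> set ms'" "eval f' g' k'"
      by (auto simp: eval_disj_list)
    then show "k \<in> set ms'"
      using minterm_true_unique sub fg(2) \<open>k \<in> set ms\<close> by blast
  qed
  \<comment> \<open>\<open>g\<close> holds on the provable-equivalence classes of the DCF formulas
    whose factor is plain in \<open>fs\<close>; formulas equivalent to no level-\<open>d\<close> DCF
    formula default to False.\<close>
  define g where "g a \<longleftrightarrow> (\<exists>ms\<in>set (subseqs (minterms v d)).
    Dia (disj_list ms) \<in> set fs \<and> Iff a (disj_list ms) \<in> logic_E)" for a
  have "congruential g"
    unfolding congruential_def g_def by (meson logic_E_Iff_trans logic_E_Iff_sym)
  moreover have "eval f g (conj_list fs)"
  proof (rule signing_true[OF m(3) distinct_modal_factors])
    fix c assume "c \<in> set (modal_factors v d)"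
    then obtain ms where ms: "ms \<in> set (subseqs (minterms v d))" "c = Dia (disj_list ms)"
      by auto
    \<comment> \<open>No other DCF formula shares the class of \<open>disj_list ms\<close>, so the
      sign of its own factor alone decides \<open>g\<close> there.\<close>
    have "ms' = ms" if "ms' \<in> set (subseqs (minterms v d))"
      "Iff (disj_list ms) (disj_list ms') \<in> logic_E" for ms'
      using subseqs_eqI_set_eq[OF distinct_minterms that(1) ms(1)]
        equivalent_subset[OF ms(1) that] equivalent_subset[OF that(1) ms(1) logic_E_Iff_sym[OF that(2)]]
      by blast
    then show "eval f g c \<longleftrightarrow> c \<in> set fs"
      unfolding ms(2) eval.simps g_def using ms(1) logic_E_Iff_refl by blast
  qed auto
  ultimately show ?case using f m(1) by auto
qed

theorem theorem1:
  fixes v d :: nat and \<phi> :: fm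
  assumes "\<phi> \<in> dcf_formulas v d"
  shows "\<phi> \<in> logic_E \<longleftrightarrow> \<phi> = disj_list (minterms v d)"
proof
  assume "\<phi> = disj_list (minterms v d)"
  then show "\<phi> \<in> logic_E"
    using minterm_true_exists by (auto intro!: logic_E.Taut simp: tautology_def eval_disj_list)
next
  assume "\<phi> \<in> logic_E"
  obtain ms where ms: "ms \<in> set (subseqs (minterms v d))" "\<phi> = disj_list ms"
    using assms by (auto simp: dcf_formulas_def)
  have sub: "set ms \<subseteq> set (minterms v d)"
    using ms(1) subseqs_powset[of "minterms v d"] by blast
  \<comment> \<open>A theorem holds in the congruential model of \<open>m\<close>, and by
    exclusivity the disjunct that makes it true is \<open>m\<close>.\<close>
  have "m \<in> set ms" if m: "m \<in> set (minterms v d)" for m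
  proof -
    obtain f g where fg: "congruential g" "eval f g m"
      using minterm_satisfiable[OF m] by blast
    then obtain m' where "m' \<in> set ms" "eval f g m'"
      using logic_E_sound[OF \<open>\<phi> \<in> logic_E\<close> fg(1), of f] ms(2) by (auto simp: eval_disj_list)
    then show ?thesis
      using minterm_true_unique[OF m _ fg(2)] sub by blast
  qed
  with sub have "set ms = set (minterms v d)" by blast
  moreover have "minterms v d \<in> set (subseqs (minterms v d))"
    by (rule subseqs_refl)
  ultimately show "\<phi> = disj_list (minterms v d)"
    using subseqs_eqI_set_eq[OF distinct_minterms ms(1)] ms(2) by blast
qed

end
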